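(* Let $R$ be an associative ring with a nonzero ideal $I$ and a semiprime ideal $T$ such that $T\subsetneq I$, and let $d:R\to R$ be a derivation of $R$. If $\mathrm{char}(R/T)\neq 2$ and $[[d(x),x],x]\in T$ for all $x\in I$, then $d$ is $T$-commuting on $I$, i.e. $[d(x),x]\in T$ for all $x\in I$.
   Context: $[x,y]=xy-yx$ for $x,y\in R$. An ideal $T$ of $R$ is semiprime if, for $a\in R$, $aRa\subseteq T$ implies $a\in T$. A derivation of $R$ is an additive map $d:R\to R$ with $d(xy)=d(x)y+xd(y)$ for all $x,y\in R$. For a nonempty subset $K\subseteq R$, a derivation $d$ is called $T$-commuting on $K$ if $[d(x),x]\in T$ for all $x\in K$. $\mathrm{char}(R/T)$ denotes the characteristic of the quotient ring $R/T$. *)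

theory Defs
  imports Main "HOL-Library.Set_Algebras"
begin

text \<open>
  An associative ring, not necessarily unital or commutative, is a type of class
  \<^class>\<open>ring\<close>. The ideals of \<open>HOL-Algebra\<close> are not used because its rings have a unit.
\<close>

definition commutator :: "'a::ring \<Rightarrow> 'a \<Rightarrow> 'a" where
  "commutator x y = x * y - y * x"

definition two_sided_ideal :: "'a::ring set \<Rightarrow> bool" where
  "two_sided_ideal I \<longleftrightarrow>
     0 \<in> I \<and>
     (\<forall>x\<in>I. \<forall>y\<in>I. x - y \<in> I) \<and>
     (\<forall>x\<in>I. \<forall>r. r * x \<in> I \<and> x * r \<in> I)"

definition semiprime_ideal :: "'a::ring set \<Rightarrow> bool" where
  "semiprime_ideal T \<longleftrightarrow>
     two_sided_ideal T \<and> (\<forall>a. {a * r * a | r. True} \<subseteq> T \<longrightarrow> a \<in> T)"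

definition derivation :: "('a::ring \<Rightarrow> 'a) \<Rightarrow> bool" where
  "derivation d \<longleftrightarrow>
     (\<forall>x y. d (x + y) = d x + d y) \<and> (\<forall>x y. d (x * y) = d x * y + x * d y)"

definition commuting_modulo :: "'a::ring set \<Rightarrow> ('a \<Rightarrow> 'a) \<Rightarrow> 'a set \<Rightarrow> bool" where
  "commuting_modulo T d K \<longleftrightarrow> (\<forall>x\<in>K. commutator (d x) x \<in> T)"

text \<open>
  The characteristic of \<open>R/T\<close>: the least \<open>n > 0\<close> with \<open>n \<cdot> (r + T) = 0 + T\<close> for every coset
  \<open>r + T\<close>, and \<open>0\<close> if there is none. As there need not be a unit, the multiple \<open>n \<cdot> r\<close> is
  written as an \<open>n\<close>-fold sum. Characteristic different from \<open>2\<close> is weaker than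
  \<open>R/T\<close> being \<open>2\<close>-torsion free (e.g. characteristic \<open>6\<close>).
\<close>

definition quotient_char :: "'a::ring set \<Rightarrow> nat" where
  "quotient_char T =
     (if \<exists>n::nat>0. \<forall>r. (\<Sum>i<n. r) +o T = 0 +o T
      then LEAST n. n > 0 \<and> (\<forall>r. (\<Sum>i<n. r) +o T = 0 +o T)
      else 0)"

end

theory Submission
  imports Defs
begin

text \<open>
  A semiprime ideal is an intersection of prime ideals, so it suffices to work modulo a prime
  ideal \<open>P\<close> not containing \<open>I\<close>. Then \<open>R/P\<close> is either \<open>2\<close>-torsion free or of characteristic \<open>2\<close>,
  and the conclusion holds in both cases. Fix \<open>x \<in> I\<close> and put \<open>a = d x\<close>, \<open>f = [a, x]\<close>.

  In the torsion free case, linearizing \<open>[[d x, x], x] \<in> P\<close> and substituting products leads, if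
  \<open>f \<notin> P\<close>, to \<open>f v a - a v f \<in> P\<close> for all \<open>v \<in> I\<close>; replacing \<open>v\<close> by \<open>v x\<close> gives \<open>f v f \<in> P\<close>.

  In characteristic \<open>2\<close> the hypothesis says that \<open>d x\<close> commutes with \<open>x\<^sup>2\<close>. Full linearization
  yields an identity in which \<open>x\<close>, \<open>x\<^sup>2\<close> can be inserted to give \<open>f w [x\<^sup>2, v] \<in> P\<close>, so that
  \<open>f \<in> P\<close> or \<open>x\<^sup>2\<close> is central modulo \<open>P\<close>; in the latter case the same identity
  gives \<open>f [w, x] [y, x] \<in> P\<close>, which again forces \<open>f \<in> P\<close>.
\<close>

section \<open>Prime and semiprime ideals\<close>

definition prime_ideal :: "'a::ring set \<Rightarrow> bool" where
  "prime_ideal P \<longleftrightarrow>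
     two_sided_ideal P \<and> (\<forall>a b. (\<forall>r. a * r * b \<in> P) \<longrightarrow> a \<in> P \<or> b \<in> P)"

context
  fixes I :: "'a::ring set"
  assumes ideal: "two_sided_ideal I"
begin

lemma ideal_zero: "0 \<in> I"
  using ideal by (simp add: two_sided_ideal_def)

lemma ideal_diff: "x \<in> I \<Longrightarrow> y \<in> I \<Longrightarrow> x - y \<in> I"
  using ideal by (simp add: two_sided_ideal_def)

lemma ideal_minus: "x \<in> I \<Longrightarrow> - x \<in> I"
  using ideal_diff[OF ideal_zero] by fastforce

lemma ideal_add: "x \<in> I \<Longrightarrow> y \<in> I \<Longrightarrow> x + y \<in> I"
  using ideal_diff[of x "- y"] ideal_minus by simp

lemma ideal_mult_left: "x \<in> I \<Longrightarrow> r * x \<in> I"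
  using ideal by (simp add: two_sided_ideal_def)

lemma ideal_mult_right: "x \<in> I \<Longrightarrow> x * r \<in> I"
  using ideal by (simp add: two_sided_ideal_def)

lemmas ideal_closed =
  ideal_zero ideal_diff ideal_minus ideal_add ideal_mult_left ideal_mult_right

end

lemma prime_ideal_imp_ideal: "prime_ideal P \<Longrightarrow> two_sided_ideal P"
  by (simp add: prime_ideal_def)

lemma two_sided_ideal_Union_chain:
  assumes "C \<noteq> {}" and "\<And>A. A \<in> C \<Longrightarrow> two_sided_ideal A"
    and "\<And>A B. A \<in> C \<Longrightarrow> B \<in> C \<Longrightarrow> A \<subseteq> B \<or> B \<subseteq> A"
  shows "two_sided_ideal (\<Union>C)"
  unfolding two_sided_ideal_def
proof (intro conjI ballI allI)
  show "0 \<in> \<Union>C"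
    using assms(1,2) ideal_zero by blast
next
  fix x y assume "x \<in> \<Union>C" "y \<in> \<Union>C"
  then obtain A where "A \<in> C" "x \<in> A" "y \<in> A"
    using assms(3) by blast
  then show "x - y \<in> \<Union>C"
    using assms(2) ideal_diff by blast
next
  fix x r assume "x \<in> \<Union>C"
  then show "r * x \<in> \<Union>C" "x * r \<in> \<Union>C"
    using assms(2) ideal_mult_left ideal_mult_right by blast+
qed

text \<open>Semiprimeness yields a sequence \<open>s\<close> outside \<open>T\<close>, starting at
  \<open>a\<close>, with each term in \<open>s n * R * s n\<close>. An ideal \<open>P\<close>
  maximal among those containing \<open>T\<close> and missing \<open>s\<close> is prime: two ideals
  strictly above \<open>P\<close> share some \<open>s n\<close>, and the next term would fall into
  \<open>P\<close>.\<close>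

lemma prime_ideal_avoiding:
  assumes T: "semiprime_ideal T" and a: "a \<notin> T"
  obtains P where "prime_ideal P" and "T \<subseteq> P" and "a \<notin> P"
proof -
  have idT: "two_sided_ideal T"
    and sp: "\<And>b. b \<notin> T \<Longrightarrow> \<exists>r. b * r * b \<notin> T"
    using T unfolding semiprime_ideal_def by blast+
  obtain g where g: "\<And>b. b \<notin> T \<Longrightarrow> b * g b * b \<notin> T"
    using sp by metis
  define s where "s n = ((\<lambda>b. b * g b * b) ^^ n) a" for n :: nat
  have s0: "s 0 = a" and sSuc: "\<And>n. s (Suc n) = s n * g (s n) * s n"
    by (simp_all add: s_def)
  have sT: "s n \<notin> T" for n
    by (induction n) (simp_all add: s0 sSuc a g)
  have s_mono: "s n \<in> J" if "two_sided_ideal J" "s m \<in> J" "m \<le> n" for J m n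
    using that(3,2)
    by (induction n rule: dec_induct) (auto simp: sSuc ideal_mult_left[OF that(1)])
  define F where "F = {J. two_sided_ideal J \<and> T \<subseteq> J \<and> (\<forall>n. s n \<notin> J)}"
  have "\<Union>C \<in> F" if "C \<noteq> {}" and C: "subset.chain F C" for C
  proof -
    have CF: "\<And>A. A \<in> C \<Longrightarrow> A \<in> F"
      and "\<And>A B. A \<in> C \<Longrightarrow> B \<in> C \<Longrightarrow> A \<subseteq> B \<or> B \<subseteq> A"
      using C by (auto simp: subset_chain_def)
    then have "two_sided_ideal (\<Union>C)"
      by (intro two_sided_ideal_Union_chain \<open>C \<noteq> {}\<close>) (auto simp: F_def)
    then show ?thesis
      using \<open>C \<noteq> {}\<close> CF by (fastforce simp: F_def)
  qed
  moreover have "F \<noteq> {}"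
    using idT sT by (auto simp: F_def)
  ultimately have "\<exists>P\<in>F. \<forall>X\<in>F. P \<subseteq> X \<longrightarrow> X = P"
    by (intro subset_Zorn_nonempty)
  then obtain P where P: "P \<in> F" and max: "\<And>X. X \<in> F \<Longrightarrow> P \<subseteq> X \<Longrightarrow> X = P"
    by blast
  have idP: "two_sided_ideal P" and TP: "T \<subseteq> P" and sP: "\<And>n. s n \<notin> P"
    using P by (auto simp: F_def)
  note cP = ideal_closed[OF idP]
  have reach: "\<exists>n. s n \<in> J" if "two_sided_ideal J" "P \<subseteq> J" "x \<in> J" "x \<notin> P" for J x
  proof (rule ccontr)
    assume "\<nexists>n. s n \<in> J"
    then have "J \<in> F" using that TP by (auto simp: F_def)
    then show False using max that by blast
  qed
  have "prime_ideal P"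
    unfolding prime_ideal_def
  proof (intro conjI allI impI idP, rule ccontr)
    fix b c assume bc: "\<forall>r. b * r * c \<in> P" and n: "\<not> (b \<in> P \<or> c \<in> P)"
    \<comment> \<open>These annihilator-type ideals stand in for the ideals generated by
      \<open>b\<close> and \<open>c\<close>; both contain \<open>P\<close>, and
      \<open>B * R * C\<close> lies in \<open>P\<close> by construction.\<close>
    define B where "B = {x. \<forall>r. x * r * c \<in> P}"
    define C where "C = {y. \<forall>x\<in>B. \<forall>r. x * r * y \<in> P}"
    have idB: "two_sided_ideal B"
      unfolding two_sided_ideal_def B_def
      by (auto simp: left_diff_distrib mult.assoc cP intro: cP) (metis mult.assoc)
    have idC: "two_sided_ideal C"
      unfolding two_sided_ideal_def C_def
      by (auto simp: right_diff_distrib cP) (metis mult.assoc, metis mult.assoc cP(6))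
    have "P \<subseteq> B" "b \<in> B" "P \<subseteq> C" "c \<in> C"
      using bc by (auto simp: B_def C_def cP)
    then obtain m k where m: "s m \<in> B" and k: "s k \<in> C"
      using reach[OF idB, of b] reach[OF idC, of c] n by auto
    have "s (max m k) \<in> B" "s (max m k) \<in> C"
      using s_mono[OF idB m] s_mono[OF idC k] by simp_all
    then have "s (Suc (max m k)) \<in> P"
      by (simp add: sSuc C_def)
    then show False using sP by blast
  qed
  moreover have "a \<notin> P" using sP[of 0] by (simp add: s0)
  ultimately show thesis using that TP by blast
qed

text \<open>One \<open>r\<close> outside \<open>P\<close> with \<open>r + r\<close> in
  \<open>P\<close> forces every \<open>s + s\<close> into \<open>P\<close>, because a factor 2 moves
  freely along a product.\<close>

lemma prime_ideal_two_cases: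
  assumes P: "prime_ideal P"
  obtains "\<And>r. r + r \<in> P" | "\<And>r. r + r \<in> P \<Longrightarrow> r \<in> P"
proof (cases "\<exists>r. r + r \<in> P \<and> r \<notin> P")
  case True
  then obtain r where r: "r + r \<in> P" "r \<notin> P" by blast
  have "r * t * (s + s) \<in> P" for s t
  proof -
    have "r * t * (s + s) = (r + r) * (t * s)"
      by (simp add: algebra_simps)
    then show ?thesis
      using r ideal_mult_right[OF prime_ideal_imp_ideal[OF P]] by simp
  qed
  then have "s + s \<in> P" for s
    using P r unfolding prime_ideal_def by blast
  then show thesis using that by blast
qed (use that in blast)

section \<open>Derivations modulo a prime ideal\<close>

text \<open>\<open>P\<close> need not be stable under \<open>d\<close>, so congruences modulo
  \<open>P\<close> are never differentiated; \<open>d\<close> is expanded only in exact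
  identities.\<close>

locale engel_modulo_prime =
  fixes P I :: "'a::ring set" and d :: "'a \<Rightarrow> 'a"
  assumes prime: "prime_ideal P"
    and I: "two_sided_ideal I"
    and not_sub: "\<not> I \<subseteq> P"
    and der: "derivation d"
    and engel: "\<And>x. x \<in> I \<Longrightarrow> commutator (commutator (d x) x) x \<in> P"
begin

lemmas P_closed = ideal_closed[OF prime_ideal_imp_ideal[OF prime]]
lemmas I_closed = ideal_closed[OF I]

lemma d_add: "d (x + y) = d x + d y"
  using der by (simp add: derivation_def)

lemma d_mult: "d (x * y) = d x * y + x * d y"
  using der by (simp add: derivation_def)

lemma d_diff: "d (x - y) = d x - d y"
  using d_add[of "x - y" y] by (simp add: algebra_simps)

text \<open>Take \<open>w = r * i * s\<close> with \<open>i\<close> in \<open>I\<close> outside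
  \<open>P\<close>, and use primeness twice.\<close>

lemma prime_on_I:
  assumes "\<And>w. w \<in> I \<Longrightarrow> a * w * b \<in> P"
  shows "a \<in> P \<or> b \<in> P"
proof -
  obtain i where i: "i \<in> I" "i \<notin> P" using not_sub by blast
  have "a * r * (i * s * b) \<in> P" for r s
    using assms[of "r * i * s"] i by (simp add: I_closed mult.assoc)
  then have "a \<in> P \<or> (\<forall>s. i * s * b \<in> P)"
    using prime unfolding prime_ideal_def by blast
  then show ?thesis
    using prime i unfolding prime_ideal_def by blast
qed

section \<open>The 2-torsion-free case\<close>

lemma commuting_torsion_free:
  assumes tf: "\<And>r. r + r \<in> P \<Longrightarrow> r \<in> P" and x: "x \<in> I"
  shows "commutator (d x) x \<in> P"
proof (rule ccontr)
  define a where "a = d x"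
  define f where "f = commutator a x"
  assume "commutator (d x) x \<notin> P"
  then have fP: "f \<notin> P" by (simp add: f_def a_def)
  note unf = commutator_def algebra_simps
  have fx: "commutator f x \<in> P"
    using engel[OF x] by (simp add: f_def a_def)

  define L where
    "L y = commutator f y + commutator (commutator a y + commutator (d y) x) x" for y
  have L: "L y \<in> P" if y: "y \<in> I" for y
  proof -
    let ?E = "\<lambda>x. commutator (commutator (d x) x) x"
    \<comment> \<open>The difference keeps twice the parts of odd degree in \<open>y\<close>: the
      linear part \<open>L y\<close> and the cubic part \<open>?E y\<close>.\<close>
    have "L y + L y = ?E (x + y) - ?E (x - y) - (?E y + ?E y)"
      by (simp add: L_def f_def a_def d_add d_diff unf)
    then have "L y + L y \<in> P"
      using engel x y by (simp add: P_closed I_closed)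
    then show ?thesis by (rule tf)
  qed

  \<comment> \<open>Passing from \<open>y\<close> to \<open>y * x\<close> or \<open>x * y\<close> in
    \<open>L\<close> eliminates \<open>d y\<close>. Repeated summands encode integer
    multiples.\<close>
  define A where
    "A y = (let s = commutator y x in s * f + s * f + s * f + commutator s x * a)" for y
  define B where
    "B y = (let s = commutator y x in f * s + f * s + f * s + a * commutator s x)" for y
  have A: "A y \<in> P" if y: "y \<in> I" for y
  proof -
    have "A y = L (y * x) - L y * x - y * (commutator f x + commutator f x + commutator f x)"
      by (simp add: A_def Let_def L_def f_def d_mult unf flip: a_def)
    then show ?thesis using L fx y by (simp add: P_closed I_closed)
  qed
  have B: "B y \<in> P" if y: "y \<in> I" for y
  proof -
    have "B y = L (x * y) - x * L y - (commutator f x + commutator f x + commutator f x) * y"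
      by (simp add: B_def Let_def L_def f_def d_mult unf flip: a_def)
    then show ?thesis using L fx y by (simp add: P_closed I_closed)
  qed

  define C where
    "C w = (let p = f * w * f; q = f * commutator w x * a in p + p + p + q + q)" for w
  define C' where
    "C' w = (let p = f * w * f; q = a * commutator w x * f in p + p + p + q + q)" for w
  have C: "C w \<in> P" if w: "w \<in> I" for w
  proof -
    have "C w = A (a * w) - a * A w - commutator f x * w * a"
      by (simp add: C_def A_def Let_def f_def unf)
    then show ?thesis using A fx w by (simp add: P_closed I_closed)
  qed
  have C': "C' w \<in> P" if w: "w \<in> I" for w
  proof -
    have "C' w = B (w * a) - B w * a - a * w * commutator f x"
      by (simp add: C'_def B_def Let_def f_def unf)
    then show ?thesis using B fx w by (simp add: P_closed I_closed)
  qed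

  \<comment> \<open>\<open>D v\<close> is what remains of \<open>C (w * a * v) - C w * v * a\<close>
    after the left factor \<open>f * w\<close>, which primeness cancels; \<open>D'\<close> is its
    mirror image.\<close>
  define D where
    "D v = (let p = a * v * f; q = a * commutator v x * a in p + p + p - f * v * a + q + q)" for v
  define D' where
    "D' v = (let p = f * v * a; q = a * commutator v x * a in p + p + p - a * v * f + q + q)" for v
  have D: "D v \<in> P" if v: "v \<in> I" for v
  proof -
    have "f * w * D v \<in> P" if w: "w \<in> I" for w
    proof -
      have "f * w * D v = C (w * a * v) - C w * v * a"
        by (simp add: C_def D_def Let_def f_def unf)
      then show ?thesis using C v w by (simp add: P_closed I_closed)
    qed
    then show ?thesis using prime_on_I fP by blast
  qed
  have D': "D' v \<in> P" if v: "v \<in> I" for v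
  proof -
    have "D' v * w * f \<in> P" if w: "w \<in> I" for w
    proof -
      have "D' v * w * f = C' (v * a * w) - a * v * C' w"
        by (simp add: C'_def D'_def Let_def f_def unf)
      then show ?thesis using C' v w by (simp add: P_closed I_closed)
    qed
    then show ?thesis using prime_on_I fP by blast
  qed

  define H where "H v = f * v * a - a * v * f" for v
  have H: "H v \<in> P" if v: "v \<in> I" for v
  proof -
    \<comment> \<open>The self-mirrored term \<open>a * commutator v x * a\<close> cancels, and
      \<open>4 * H v\<close> is halved twice.\<close>
    have "(H v + H v) + (H v + H v) = D' v - D v"
      by (simp add: H_def D_def D'_def Let_def algebra_simps)
    then show ?thesis using D[OF v] D'[OF v] tf by (metis P_closed(2))
  qed
  have "f * v * f \<in> P" if v: "v \<in> I" for v
  proof -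
    have "f * v * f = H v * x - H (v * x) + a * v * commutator f x"
      by (simp add: H_def f_def unf)
    then show ?thesis using H fx v by (simp add: P_closed I_closed)
  qed
  then show False using prime_on_I fP by blast
qed

section \<open>The case of characteristic 2\<close>

lemma commuting_char_two:
  assumes two: "\<And>r. r + r \<in> P" and x: "x \<in> I"
  shows "commutator (d x) x \<in> P"
proof (rule ccontr)
  define a where "a = d x"
  define f where "f = commutator a x"
  assume "commutator (d x) x \<notin> P"
  then have fP: "f \<notin> P" by (simp add: f_def a_def)
  note unf = commutator_def algebra_simps
  have fx: "commutator f x \<in> P"
    using engel[OF x] by (simp add: f_def a_def)

  \<comment> \<open>Modulo 2 this is the trilinear part of the Engel expression: the Jacobi identity
    merges its six double commutators in pairs.\<close>
  define T where "T x y z = commutator (d x) (commutator y z)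
    + commutator (d y) (commutator x z) + commutator (d z) (commutator x y)" for x y z
  have T: "T x y z \<in> P" if "x \<in> I" "y \<in> I" "z \<in> I" for x y z
  proof -
    let ?E = "\<lambda>x. commutator (commutator (d x) x) x"
    let ?r = "commutator (commutator (d x) z) y + commutator (commutator (d y) z) x
      + commutator (commutator (d z) y) x"
    have "T x y z = ?E (x + y + z) - ?E (x + y) - ?E (y + z) - ?E (x + z)
      + ?E x + ?E y + ?E z - (?r + ?r)"
      by (simp add: T_def d_add unf)
    then show ?thesis
      using engel that two[of ?r] by (simp add: P_closed I_closed)
  qed

  \<comment> \<open>\<open>G\<close> measures the failure of \<open>T x y\<close> to be a
    derivation; \<open>F\<close> then isolates a free middle factor \<open>w\<close>, ready for
    primeness.\<close>
  define G where "G x y z w = commutator y z * commutator (d x) w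
    + commutator (d x) z * commutator y w + commutator x z * commutator (d y) w
    + commutator (d y) z * commutator x w + d z * commutator w (commutator x y)
    + commutator z (commutator x y) * d w" for x y z w
  have G: "G x y z w \<in> P" if "x \<in> I" "y \<in> I" "z \<in> I" "w \<in> I" for x y z w
  proof -
    have "G x y z w = T x y (z * w) - T x y z * w - z * T x y w"
      by (simp add: G_def T_def d_mult unf)
    then show ?thesis using T that by (simp add: P_closed I_closed)
  qed

  define F where "F x y z w v = commutator y z * w * commutator (d x) v
    + commutator (d x) z * w * commutator y v + commutator x z * w * commutator (d y) v
    + commutator (d y) z * w * commutator x v + d z * w * commutator v (commutator x y)
    + commutator z (commutator x y) * w * d v" for x y z w v
  have F: "F x y z w v \<in> P" if "x \<in> I" "y \<in> I" "z \<in> I" "w \<in> I" "v \<in> I" for x y z w v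
  proof -
    have "F x y z w v = G x y z (w * v) - G x y z w * v"
      by (simp add: F_def G_def d_mult unf)
    then show ?thesis using G that by (simp add: P_closed I_closed)
  qed

  have "f * w * commutator (x * x) v \<in> P" if w: "w \<in> I" and v: "v \<in> I" for w v
  proof -
    \<comment> \<open>With \<open>y = x * x\<close> and \<open>z = x\<close> only two terms of
      \<open>F\<close> survive; the unwanted one has left factor
      \<open>commutator (d (x * x)) x = x * f + f * x\<close>, which is in \<open>P\<close>.\<close>
    have "f * w * commutator (x * x) v
      = F x (x * x) x w v - (x * f + x * f + commutator f x) * w * commutator x v"
      by (simp add: F_def f_def d_mult unf flip: a_def)
    then show ?thesis
      using F w v x fx two[of "x * f"] by (simp add: P_closed I_closed)
  qed
  then have xx: "commutator (x * x) v \<in> P" if "v \<in> I" for v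
    using prime_on_I fP that by blast
  have xxy: "commutator x (commutator x y) \<in> P" if "y \<in> I" for y
  proof -
    let ?r = "y * x * x - x * y * x"
    \<comment> \<open>Modulo 2 the square of ad \<open>x\<close> is ad \<open>x * x\<close>.\<close>
    have "commutator x (commutator x y) = commutator (x * x) y + (?r + ?r)"
      by (simp add: unf)
    then show ?thesis using xx that two[of ?r] by (simp add: P_closed)
  qed

  define M where "M y w = commutator y x * w * f + f * w * commutator y x" for y w
  have M: "M y w \<in> P" if "y \<in> I" "w \<in> I" for y w
  proof -
    have "M y w = F x y x w x - a * w * commutator x (commutator x y)
      - commutator x (commutator x y) * w * a"
      by (simp add: F_def M_def f_def unf flip: a_def)
    then show ?thesis using F x xxy that by (simp add: P_closed)
  qed
  define K where "K w y = f * commutator w x * commutator y x" for w y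
  have K: "K w y \<in> P" if "w \<in> I" "y \<in> I" for w y
  proof -
    \<comment> \<open>Shifting \<open>x\<close> from \<open>y\<close> to \<open>w\<close> cancels
      the terms ending in \<open>f\<close>.\<close>
    have "K w y = M (y * x) w - M y (x * w) - f * w * commutator x (commutator x y)"
      by (simp add: K_def M_def unf)
    then show ?thesis using M x xxy that by (simp add: P_closed I_closed)
  qed

  have central: False if c: "\<And>y. y \<in> I \<Longrightarrow> commutator y x \<in> P"
  proof -
    have "f * y * f \<in> P" if y: "y \<in> I" for y
    proof -
      \<comment> \<open>If \<open>x\<close> commutes with \<open>I\<close> modulo \<open>P\<close>,
        testing this on \<open>a * y\<close> gives \<open>f * y\<close> in \<open>P\<close>.\<close>
      have "f * y * f = (commutator (a * y) x - a * commutator y x) * f"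
        by (simp add: f_def unf)
      then show ?thesis using c y by (simp add: P_closed I_closed)
    qed
    then show False using prime_on_I fP by blast
  qed
  have fw: "f * commutator w x \<in> P" if w: "w \<in> I" for w
  proof (rule ccontr)
    assume n: "f * commutator w x \<notin> P"
    have "commutator y x \<in> P" if y: "y \<in> I" for y
    proof -
      have "f * commutator w x * v * commutator y x \<in> P" if v: "v \<in> I" for v
      proof -
        have "f * commutator w x * v * commutator y x = K w (v * y) - K w v * y"
          by (simp add: K_def unf)
        then show ?thesis using K v w y by (simp add: P_closed I_closed)
      qed
      then show ?thesis using prime_on_I n by blast
    qed
    then show False by (rule central)
  qed
  have "commutator y x \<in> P" if y: "y \<in> I" for y
  proof -
    have "f * w * commutator y x \<in> P" if w: "w \<in> I" for w
    proof -
      have "f * w * commutator y x = f * commutator (w * y) x - f * commutator w x * y"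
        by (simp add: unf)
      then show ?thesis using fw w y by (simp add: P_closed I_closed)
    qed
    then show ?thesis using prime_on_I fP by blast
  qed
  then show False by (rule central)
qed

lemma commuting: "x \<in> I \<Longrightarrow> commutator (d x) x \<in> P"
  using prime_ideal_two_cases[OF prime] commuting_torsion_free commuting_char_two by metis

end

section \<open>From prime ideals back to the semiprime ideal\<close>

theorem theorem2p1:
  fixes I T :: "'a::ring set" and d :: "'a \<Rightarrow> 'a"
  assumes "two_sided_ideal I" and "I \<noteq> {0}"
    and "semiprime_ideal T" and "T \<subset> I"
    and "derivation d"
    and "quotient_char T \<noteq> 2"
    and "\<forall>x\<in>I. commutator (commutator (d x) x) x \<in> T"
  shows "commuting_modulo T d I"
  unfolding commuting_modulo_def
proof (intro ballI, rule ccontr)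
  fix x assume x: "x \<in> I" and "commutator (d x) x \<notin> T"
  then obtain P where P: "prime_ideal P" "T \<subseteq> P" "commutator (d x) x \<notin> P"
    using prime_ideal_avoiding[OF assms(3)] by blast
  \<comment> \<open>This element of \<open>I\<close> outside \<open>P\<close> witnesses that
    \<open>I\<close> is not contained in \<open>P\<close>.\<close>
  have "commutator (d x) x \<in> I"
    using x by (simp add: commutator_def ideal_closed[OF assms(1)])
  then interpret engel_modulo_prime P I d
    using P assms by unfold_locales auto
  show False using commuting[OF x] P(3) by blast
qed

end
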